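(* Let $V$ be a finite-dimensional representation of a finite group $G$ over a field $k$, and let $H\subseteq G$ be a subgroup, so that $V$ is a representation of $H$ by restriction. Then $$D_{\mathrm{span}}(H,V)\leq D_{\mathrm{span}}(G,V).$$
   Context: For a finite-dimensional representation $V$ of a finite group $G$ over a field $k$: $k[V]$ is the ring of polynomial functions on $V$ (the symmetric algebra of $V^*$), with $G$-action $(gf)(v)=f(g^{-1}v)$; $k(V)$ is its fraction field and $k(V)^G$ the field of $G$-invariant rational functions; $k[V]_{\le d}$ is the space of polynomials of degree at most $d$. The spanning degree $D_{\mathrm{span}}(G,V)$ is the minimum $d\in\mathbb{N}=\{0,1,2,\dots\}$ such that $k[V]_{\le d}$ spans $k(V)$ as a vector space over $k(V)^G$. *)

theory Defs
  imports
    Complex_Main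
    "HOL-Algebra.Group_Action"
    "HOL-Library.Poly_Mapping"
    "HOL-Computational_Algebra.Fraction_Field"
begin

section \<open>Polynomials in the variables \<open>x\<^sub>0, x\<^sub>1, \<dots>\<close>\<close>

type_synonym 'k mpoly = "(nat \<Rightarrow>\<^sub>0 nat) \<Rightarrow>\<^sub>0 'k"

definition Const :: "'k::field \<Rightarrow> 'k mpoly"
  where "Const a = Poly_Mapping.single 0 a"

definition Var :: "nat \<Rightarrow> 'k::field mpoly"
  where "Var i = Poly_Mapping.single (Poly_Mapping.single i 1) 1"

definition mono_val :: "(nat \<Rightarrow> 'a::comm_ring_1) \<Rightarrow> (nat \<Rightarrow>\<^sub>0 nat) \<Rightarrow> 'a"
  where "mono_val \<sigma> m = (\<Prod>i\<in>Poly_Mapping.keys m. \<sigma> i ^ Poly_Mapping.lookup m i)"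

text \<open>Apply \<open>c\<close> to the coefficients and replace each \<open>x\<^sub>i\<close> by \<open>\<sigma> i\<close>: substitution of
  polynomials for \<open>c = Const\<close>, evaluation at a point for \<open>c = (\<lambda>a. a)\<close>.\<close>

definition mpoly_hom :: "('k::field \<Rightarrow> 'a::comm_ring_1) \<Rightarrow> (nat \<Rightarrow> 'a) \<Rightarrow> 'k mpoly \<Rightarrow> 'a"
  where "mpoly_hom c \<sigma> p =
    (\<Sum>m\<in>Poly_Mapping.keys p. c (Poly_Mapping.lookup p m) * mono_val \<sigma> m)"

definition mono_deg :: "(nat \<Rightarrow>\<^sub>0 nat) \<Rightarrow> nat"
  where "mono_deg m = (\<Sum>i\<in>Poly_Mapping.keys m. Poly_Mapping.lookup m i)"

definition poly_ring :: "nat \<Rightarrow> 'k::field mpoly set"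
  where "poly_ring n = {p. \<forall>m\<in>Poly_Mapping.keys p. Poly_Mapping.keys m \<subseteq> {..<n}}"

definition poly_deg_le :: "nat \<Rightarrow> nat \<Rightarrow> 'k::field mpoly set"
  where "poly_deg_le n d = {p \<in> poly_ring n. \<forall>m\<in>Poly_Mapping.keys p. mono_deg m \<le> d}"

definition rat_field :: "nat \<Rightarrow> 'k::field mpoly fract set"
  where "rat_field n = {Fract p q | p q. p \<in> poly_ring n \<and> q \<in> poly_ring n \<and> q \<noteq> 0}"


section \<open>Representations and coordinates\<close>

locale linear_representation = group_action G UNIV \<rho> + vector_space scale
  for G :: "('g, 'm) monoid_scheme" (structure)
    and scale :: "'k::field \<Rightarrow> 'v::ab_group_add \<Rightarrow> 'v"
    and \<rho> :: "'g \<Rightarrow> 'v \<Rightarrow> 'v" +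
  assumes linear_rho: "g \<in> carrier G \<Longrightarrow> Vector_Spaces.linear scale scale (\<rho> g)"

definition finite_dim :: "('k::field \<Rightarrow> 'v::ab_group_add \<Rightarrow> 'v) \<Rightarrow> bool"
  where "finite_dim scale \<longleftrightarrow> (\<exists>B. finite B \<and> module.span scale B = UNIV)"

definition ordered_basis :: "('k::field \<Rightarrow> 'v::ab_group_add \<Rightarrow> 'v) \<Rightarrow> 'v list \<Rightarrow> bool"
  where "ordered_basis scale bs \<longleftrightarrow>
    distinct bs \<and> \<not> module.dependent scale (set bs) \<and> module.span scale (set bs) = UNIV"

definition coord :: "('k::field \<Rightarrow> 'v::ab_group_add \<Rightarrow> 'v) \<Rightarrow> 'v list \<Rightarrow> nat \<Rightarrow> 'v \<Rightarrow> 'k"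
  where "coord scale bs i v = module.representation scale (set bs) v (bs ! i)"

text \<open>A basis \<open>bs\<close> of \<open>V\<close> of length \<open>n\<close> identifies the symmetric algebra \<open>k[V]\<close> of the dual space
  with \<^term>\<open>poly_ring n\<close> (and \<open>k(V)\<close> with \<^term>\<open>rat_field n\<close>), where \<^term>\<open>Var i\<close> is the \<open>i\<close>-th
  coordinate function. Under this identification the linear functional \<open>\<phi>\<close> is
  \<open>lin_form bs \<phi>\<close>. These are formal polynomials, so \<open>k\<close> may be finite.\<close>

definition lin_form :: "'v list \<Rightarrow> ('v \<Rightarrow> 'k::field) \<Rightarrow> 'k mpoly"
  where "lin_form bs \<phi> = (\<Sum>j<length bs. Const (\<phi> (bs ! j)) * Var j)"

text \<open>\<open>f \<mapsto> f \<circ> T\<close>, with \<open>f\<close> written in the coordinates of \<open>bs\<close> and \<open>f \<circ> T\<close> in those of \<open>cs\<close>;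
  \<open>eval_pullback\<close> below confirms this on points of \<open>V\<close>.\<close>

definition pullback ::
    "('k::field \<Rightarrow> 'v::ab_group_add \<Rightarrow> 'v) \<Rightarrow> 'v list \<Rightarrow> 'v list \<Rightarrow> ('v \<Rightarrow> 'v) \<Rightarrow> 'k mpoly \<Rightarrow> 'k mpoly"
  where "pullback scale bs cs T = mpoly_hom Const (\<lambda>i. lin_form cs (coord scale bs i \<circ> T))"

text \<open>Well-defined for \<open>T\<close> linear and bijective, see \<open>pullback_rat_Fract\<close> below.\<close>

definition pullback_rat ::
    "('k::field \<Rightarrow> 'v::ab_group_add \<Rightarrow> 'v) \<Rightarrow> 'v list \<Rightarrow> 'v list \<Rightarrow> ('v \<Rightarrow> 'v)
      \<Rightarrow> 'k mpoly fract \<Rightarrow> 'k mpoly fract"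
  where "pullback_rat scale bs cs T x =
    (THE y. \<exists>p\<in>poly_ring (length bs). \<exists>q\<in>poly_ring (length bs). q \<noteq> 0 \<and> x = Fract p q \<and>
       y = Fract (pullback scale bs cs T p) (pullback scale bs cs T q))"

text \<open>\<open>(g f)(v) = f (g\<^sup>-\<^sup>1 v)\<close>\<close>

definition act_rat ::
    "('g, 'm) monoid_scheme \<Rightarrow> ('k::field \<Rightarrow> 'v::ab_group_add \<Rightarrow> 'v) \<Rightarrow> ('g \<Rightarrow> 'v \<Rightarrow> 'v) \<Rightarrow> 'v list
      \<Rightarrow> 'g \<Rightarrow> 'k mpoly fract \<Rightarrow> 'k mpoly fract"
  where "act_rat G scale \<rho> bs g = pullback_rat scale bs bs (\<rho> (inv\<^bsub>G\<^esub> g))"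

definition inv_field ::
    "('g, 'm) monoid_scheme \<Rightarrow> ('k::field \<Rightarrow> 'v::ab_group_add \<Rightarrow> 'v) \<Rightarrow> ('g \<Rightarrow> 'v \<Rightarrow> 'v) \<Rightarrow> 'v list
      \<Rightarrow> 'k mpoly fract set"
  where "inv_field G scale \<rho> bs =
    {x \<in> rat_field (length bs). \<forall>g\<in>carrier G. act_rat G scale \<rho> bs g x = x}"


section \<open>The spanning degree\<close>

definition span_over :: "'a::comm_ring_1 set \<Rightarrow> 'a set \<Rightarrow> 'a set"
  where "span_over F A = {\<Sum>a\<in>S. c a * a | S c. finite S \<and> S \<subseteq> A \<and> c ` S \<subseteq> F}"

definition spans_in_degree ::
    "('g, 'm) monoid_scheme \<Rightarrow> ('k::field \<Rightarrow> 'v::ab_group_add \<Rightarrow> 'v) \<Rightarrow> ('g \<Rightarrow> 'v \<Rightarrow> 'v) \<Rightarrow> 'v list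
      \<Rightarrow> nat \<Rightarrow> bool"
  where "spans_in_degree G scale \<rho> bs d \<longleftrightarrow>
    span_over (inv_field G scale \<rho> bs) ((\<lambda>p. Fract p 1) ` poly_deg_le (length bs) d)
      = rat_field (length bs)"

text \<open>The choice of basis is immaterial, see \<open>D_span_eq\<close> below.\<close>

definition D_span ::
    "('g, 'm) monoid_scheme \<Rightarrow> ('k::field \<Rightarrow> 'v::ab_group_add \<Rightarrow> 'v) \<Rightarrow> ('g \<Rightarrow> 'v \<Rightarrow> 'v) \<Rightarrow> nat"
  where "D_span G scale \<rho> =
    (LEAST d. spans_in_degree G scale \<rho> (SOME bs. ordered_basis scale bs) d)"


section \<open>Substitution is a homomorphism\<close>

lemma poly_mapping_decomp:
  fixes p :: "'a \<Rightarrow>\<^sub>0 'b::comm_monoid_add"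
  shows "(\<Sum>m\<in>Poly_Mapping.keys p. Poly_Mapping.single m (Poly_Mapping.lookup p m)) = p"
  by (rule poly_mapping_eqI)
     (auto simp: lookup_sum lookup_single when_def in_keys_iff)

lemma mono_val_superset:
  assumes "finite A" "Poly_Mapping.keys m \<subseteq> A"
  shows "mono_val \<sigma> m = (\<Prod>i\<in>A. \<sigma> i ^ Poly_Mapping.lookup m i)"
  unfolding mono_val_def using assms
  by (intro prod.mono_neutral_left) (auto simp: in_keys_iff)

lemma mono_val_0 [simp]: "mono_val \<sigma> 0 = 1"
  by (simp add: mono_val_def)

lemma mono_val_add: "mono_val \<sigma> (m + m') = mono_val \<sigma> m * mono_val \<sigma> m'"
proof -
  let ?A = "Poly_Mapping.keys m \<union> Poly_Mapping.keys m'"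
  have "finite ?A" "Poly_Mapping.keys (m + m') \<subseteq> ?A"
    using Poly_Mapping.keys_add[of m m'] by auto
  then show ?thesis
    by (simp add: mono_val_superset[of ?A] lookup_add power_add prod.distrib)
qed

locale coeff_hom =
  fixes c :: "'k::field \<Rightarrow> 'a::comm_ring_1"
  assumes c_add: "c (a + b) = c a + c b"
    and c_mult: "c (a * b) = c a * c b"
    and c_1: "c 1 = 1"
begin

lemma c_0: "c 0 = 0"
  using c_add[of 0 0] by simp

lemma hom_add: "mpoly_hom c \<sigma> (p + q) = mpoly_hom c \<sigma> p + mpoly_hom c \<sigma> q"
  unfolding mpoly_hom_def
  by (rule setsum_keys_plus_distrib) (simp_all add: c_0 c_add distrib_right)

lemma hom_0 [simp]: "mpoly_hom c \<sigma> 0 = 0"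
  by (simp add: mpoly_hom_def)

lemma hom_single: "mpoly_hom c \<sigma> (Poly_Mapping.single m a) = c a * mono_val \<sigma> m"
  by (simp add: mpoly_hom_def c_0)

lemma hom_sum: "mpoly_hom c \<sigma> (sum f A) = (\<Sum>x\<in>A. mpoly_hom c \<sigma> (f x))"
  by (induction A rule: infinite_finite_induct) (simp_all add: hom_add)

lemma hom_mult: "mpoly_hom c \<sigma> (p * q) = mpoly_hom c \<sigma> p * mpoly_hom c \<sigma> q"
proof -
  let ?s = "\<lambda>p m. Poly_Mapping.single m (Poly_Mapping.lookup p m)"
  have "p * q = (\<Sum>m\<in>Poly_Mapping.keys p. ?s p m) * (\<Sum>m\<in>Poly_Mapping.keys q. ?s q m)"
    by (simp only: poly_mapping_decomp)
  also have "\<dots> = (\<Sum>m\<in>Poly_Mapping.keys p. \<Sum>m'\<in>Poly_Mapping.keys q. ?s p m * ?s q m')"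
    by (simp add: sum_product)
  finally have "mpoly_hom c \<sigma> (p * q) = (\<Sum>m\<in>Poly_Mapping.keys p. \<Sum>m'\<in>Poly_Mapping.keys q.
      (c (Poly_Mapping.lookup p m) * mono_val \<sigma> m) * (c (Poly_Mapping.lookup q m') * mono_val \<sigma> m'))"
    by (simp add: hom_sum hom_single mult_single c_mult mono_val_add mult_ac)
  then show ?thesis
    by (simp add: mpoly_hom_def sum_product)
qed

lemma hom_Const [simp]: "mpoly_hom c \<sigma> (Const a) = c a"
  by (simp add: Const_def hom_single)

lemma hom_1 [simp]: "mpoly_hom c \<sigma> 1 = 1"
  using hom_Const[of \<sigma> 1] by (simp add: Const_def c_1)

lemma hom_Var [simp]: "mpoly_hom c \<sigma> (Var i) = \<sigma> i"
  by (simp add: Var_def hom_single c_1 mono_val_def)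

lemma hom_power: "mpoly_hom c \<sigma> (p ^ e) = mpoly_hom c \<sigma> p ^ e"
  by (induction e) (simp_all add: hom_mult)

lemma hom_prod: "mpoly_hom c \<sigma> (prod f A) = (\<Prod>x\<in>A. mpoly_hom c \<sigma> (f x))"
  by (induction A rule: infinite_finite_induct) (simp_all add: hom_mult)

lemma hom_comp: "mpoly_hom c \<sigma> (mpoly_hom Const \<tau> p) = mpoly_hom c (\<lambda>i. mpoly_hom c \<sigma> (\<tau> i)) p"
  by (simp add: mpoly_hom_def[of Const] hom_sum hom_mult mono_val_def hom_prod hom_power)
     (simp add: mpoly_hom_def mono_val_def)

end

lemma mpoly_hom_cong:
  assumes "p \<in> poly_ring n" "\<And>i. i < n \<Longrightarrow> \<sigma> i = \<tau> i"
  shows "mpoly_hom c \<sigma> p = mpoly_hom c \<tau> p"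
proof -
  have "\<sigma> i = \<tau> i" if "m \<in> Poly_Mapping.keys p" "i \<in> Poly_Mapping.keys m" for m i
    using assms that by (auto simp: poly_ring_def)
  then show ?thesis
    unfolding mpoly_hom_def mono_val_def
    by (intro sum.cong refl arg_cong2[where f = "(*)"] prod.cong) simp_all
qed

interpretation Const: coeff_hom Const
  by unfold_locales (simp_all add: Const_def single_add mult_single)

interpretation eval: coeff_hom "\<lambda>a. a"
  by unfold_locales simp_all

lemma Var_power: "Var i ^ e = Poly_Mapping.single (Poly_Mapping.single i e) 1"
  by (induction e) (simp_all add: Var_def mult_single single_add[symmetric])

lemma prod_single_1:
  "(\<Prod>x\<in>A. Poly_Mapping.single (f x) (1::'k::field)) = Poly_Mapping.single (\<Sum>x\<in>A. f x :: nat \<Rightarrow>\<^sub>0 nat) 1"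
  by (induction A rule: infinite_finite_induct) (simp_all add: mult_single)

lemma mpoly_hom_Var:
  fixes p :: "'k::field mpoly"
  shows "mpoly_hom Const Var p = p"
proof -
  have "mono_val Var m = Poly_Mapping.single m (1::'k::field)" for m
    by (simp add: mono_val_def Var_power prod_single_1 poly_mapping_decomp)
  then have "mpoly_hom Const Var p =
      (\<Sum>m\<in>Poly_Mapping.keys p. Poly_Mapping.single m (Poly_Mapping.lookup p m))"
    by (simp add: mpoly_hom_def Const_def mult_single)
  then show ?thesis
    by (simp only: poly_mapping_decomp)
qed


section \<open>Degrees\<close>

lemma mono_deg_superset:
  assumes "finite A" "Poly_Mapping.keys m \<subseteq> A"
  shows "mono_deg m = (\<Sum>i\<in>A. Poly_Mapping.lookup m i)"
  unfolding mono_deg_def using assms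
  by (intro sum.mono_neutral_left) (auto simp: in_keys_iff)

lemma mono_deg_add: "mono_deg (m + m') = mono_deg m + mono_deg m'"
proof -
  let ?A = "Poly_Mapping.keys m \<union> Poly_Mapping.keys m'"
  have "finite ?A" "Poly_Mapping.keys (m + m') \<subseteq> ?A"
    using Poly_Mapping.keys_add[of m m'] by auto
  then show ?thesis
    by (simp add: mono_deg_superset[of ?A] lookup_add sum.distrib)
qed

lemma deg_le_mono: "p \<in> poly_deg_le n d \<Longrightarrow> d \<le> e \<Longrightarrow> p \<in> poly_deg_le n e"
  by (auto simp: poly_deg_le_def)

lemma deg_le_0 [simp]: "0 \<in> poly_deg_le n d"
  by (simp add: poly_deg_le_def poly_ring_def)

lemma deg_le_add:
  assumes "p \<in> poly_deg_le n d" "q \<in> poly_deg_le n d"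
  shows "p + q \<in> poly_deg_le n d"
  using assms Poly_Mapping.keys_add[of p q] unfolding poly_deg_le_def poly_ring_def by blast

lemma deg_le_sum: "(\<And>x. x \<in> A \<Longrightarrow> f x \<in> poly_deg_le n d) \<Longrightarrow> sum f A \<in> poly_deg_le n d"
  by (induction A rule: infinite_finite_induct) (auto intro: deg_le_add)

lemma deg_le_mult:
  assumes "p \<in> poly_deg_le n d" "q \<in> poly_deg_le n e"
  shows "p * q \<in> poly_deg_le n (d + e)"
proof -
  have "Poly_Mapping.keys m \<subseteq> {..<n} \<and> mono_deg m \<le> d + e"
    if m: "m \<in> Poly_Mapping.keys (p * q)" for m
  proof -
    obtain a b where ab: "m = a + b" "a \<in> Poly_Mapping.keys p" "b \<in> Poly_Mapping.keys q"
      using m Poly_Mapping.keys_mult[of p q] by blast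
    then show ?thesis
      using assms Poly_Mapping.keys_add[of a b]
      by (fastforce simp: poly_deg_le_def poly_ring_def mono_deg_add intro: add_mono)
  qed
  then show ?thesis
    by (auto simp: poly_deg_le_def poly_ring_def)
qed

lemma deg_le_Const [simp]: "Const a \<in> poly_deg_le n d"
  by (auto simp: Const_def poly_deg_le_def poly_ring_def mono_deg_def)

lemma deg_le_1 [simp]: "1 \<in> poly_deg_le n d"
  using deg_le_Const[of 1] by (simp add: Const_def)

lemma deg_le_Var: "i < n \<Longrightarrow> Var i \<in> poly_deg_le n 1"
  by (auto simp: Var_def poly_deg_le_def poly_ring_def mono_deg_def)

lemma deg_le_power: "p \<in> poly_deg_le n 1 \<Longrightarrow> p ^ e \<in> poly_deg_le n e"
proof (induction e)
  case (Suc e)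
  then show ?case using deg_le_mult[of p n 1 "p ^ e" e] by simp
qed simp

lemma deg_le_prod:
  "(\<And>x. x \<in> A \<Longrightarrow> f x \<in> poly_deg_le n (e x)) \<Longrightarrow> finite A \<Longrightarrow> prod f A \<in> poly_deg_le n (sum e A)"
proof (induction A rule: infinite_finite_induct)
  case (insert x A)
  then show ?case using deg_le_mult[of "f x" n "e x" "prod f A" "sum e A"] by auto
qed auto

lemma deg_le_lin_form: "lin_form bs \<phi> \<in> poly_deg_le (length bs) 1"
  unfolding lin_form_def
proof (rule deg_le_sum)
  fix j assume "j \<in> {..<length bs}"
  then show "Const (\<phi> (bs ! j)) * Var j \<in> poly_deg_le (length bs) 1"
    using deg_le_mult[OF deg_le_Const[of "\<phi> (bs ! j)" "length bs" 0] deg_le_Var[of j "length bs"]]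
    by simp
qed

lemma pullback_deg_le:
  assumes "p \<in> poly_deg_le n d"
  shows "pullback scale bs cs T p \<in> poly_deg_le (length cs) d"
  unfolding pullback_def mpoly_hom_def
proof (rule deg_le_sum)
  fix m assume m: "m \<in> Poly_Mapping.keys p"
  let ?\<sigma> = "\<lambda>i. lin_form cs (coord scale bs i \<circ> T)"
  have "mono_val ?\<sigma> m \<in> poly_deg_le (length cs) (mono_deg m)"
    unfolding mono_val_def mono_deg_def
    by (intro deg_le_prod deg_le_power deg_le_lin_form) simp
  then have "Const (Poly_Mapping.lookup p m) * mono_val ?\<sigma> m
      \<in> poly_deg_le (length cs) (0 + mono_deg m)"
    by (intro deg_le_mult) simp_all
  then show "Const (Poly_Mapping.lookup p m) * mono_val ?\<sigma> m \<in> poly_deg_le (length cs) d"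
    by (rule deg_le_mono) (use m assms in \<open>simp add: poly_deg_le_def\<close>)
qed

lemma poly_ring_iff: "p \<in> poly_ring n \<longleftrightarrow> (\<exists>d. p \<in> poly_deg_le n d)"
proof
  assume "p \<in> poly_ring n"
  then have "p \<in> poly_deg_le n (\<Sum>m\<in>Poly_Mapping.keys p. mono_deg m)"
    by (auto simp: poly_deg_le_def intro: member_le_sum)
  then show "\<exists>d. p \<in> poly_deg_le n d" ..
qed (auto simp: poly_deg_le_def)

lemma pullback_poly_ring:
  "p \<in> poly_ring n \<Longrightarrow> pullback scale bs cs T p \<in> poly_ring (length cs)"
  by (auto simp: poly_ring_iff intro: pullback_deg_le)

lemma poly_ring_1 [simp]: "1 \<in> poly_ring n"
  by (auto simp: poly_ring_iff intro: deg_le_1)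

lemma poly_ring_mult: "p \<in> poly_ring n \<Longrightarrow> q \<in> poly_ring n \<Longrightarrow> p * q \<in> poly_ring n"
  by (auto simp: poly_ring_iff intro: deg_le_mult)

lemma poly_ring_add:
  assumes "p \<in> poly_ring n" "q \<in> poly_ring n"
  shows "p + q \<in> poly_ring n"
  using assms Poly_Mapping.keys_add[of p q] unfolding poly_ring_def by blast


section \<open>Pullback is functorial\<close>

lemma pullback_add: "pullback s bs cs T (p + q) = pullback s bs cs T p + pullback s bs cs T q"
  and pullback_mult: "pullback s bs cs T (p * q) = pullback s bs cs T p * pullback s bs cs T q"
  and pullback_0 [simp]: "pullback s bs cs T 0 = 0"
  and pullback_1 [simp]: "pullback s bs cs T 1 = 1"
  by (simp_all add: pullback_def Const.hom_add Const.hom_mult)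

text \<open>A copy of \<^locale>\<open>vector_space\<close> for the lemmas below: that locale has global interpretations,
  which would all inherit the abbreviations.\<close>

locale coordinates = vector_space scale
  for scale :: "'a::field \<Rightarrow> 'b::ab_group_add \<Rightarrow> 'b"
begin

lemma Const_sum: "Const (sum f A) = (\<Sum>x\<in>A. Const (f x))"
  by (induction A rule: infinite_finite_induct) (simp_all add: Const.c_0 Const.c_add)

abbreviation functional :: "('b \<Rightarrow> 'a) \<Rightarrow> bool"
  where "functional \<phi> \<equiv> (\<forall>u v. \<phi> (u + v) = \<phi> u + \<phi> v) \<and> (\<forall>a v. \<phi> (scale a v) = a * \<phi> v)"

lemma functional_sum:
  fixes \<phi> :: "'b \<Rightarrow> 'a"
  shows "functional \<phi> \<Longrightarrow> \<phi> (\<Sum>x\<in>A. scale (f x) (g x)) = (\<Sum>x\<in>A. f x * \<phi> (g x))"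
proof (induction A rule: infinite_finite_induct)
  case (infinite A)
  have "\<phi> (scale 0 0) = 0 * \<phi> 0" using infinite by blast
  then show ?case using infinite(1) by simp
next
  case empty
  have "\<phi> (scale 0 0) = 0 * \<phi> 0" using empty by blast
  then show ?case by simp
qed simp

lemma functional_coord: "ordered_basis scale bs \<Longrightarrow> functional (coord scale bs i)"
  by (auto simp: ordered_basis_def coord_def representation_add representation_scale)

lemma functional_comp:
  "functional \<phi> \<Longrightarrow> Vector_Spaces.linear scale scale T \<Longrightarrow> functional (\<phi> \<circ> T)"
  by (simp add: Vector_Spaces.linear_iff)

lemma basis_expansion:
  assumes "ordered_basis scale bs"
  shows "(\<Sum>j<length bs. scale (coord scale bs j v) (bs ! j)) = v"
proof -
  have "(\<Sum>j<length bs. scale (coord scale bs j v) (bs ! j))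
      = (\<Sum>b\<in>set bs. scale (representation (set bs) v b) b)"
    unfolding coord_def using assms
    by (intro sum.reindex_bij_betw) (auto simp: ordered_basis_def intro: bij_betw_nth)
  then show ?thesis
    using assms by (simp add: ordered_basis_def sum_representation_eq)
qed

lemma coord_basis:
  assumes "ordered_basis scale bs" "i < length bs" "j < length bs"
  shows "coord scale bs i (bs ! j) = (if j = i then 1 else 0)"
  using assms by (auto simp: coord_def ordered_basis_def representation_basis nth_eq_iff_index_eq)

lemma pullback_lin_form:
  assumes "ordered_basis scale bs" "functional \<phi>"
  shows "pullback scale bs cs T (lin_form bs \<phi>) = lin_form cs (\<phi> \<circ> T)"
proof -
  have exp: "\<phi> v = (\<Sum>j<length bs. coord scale bs j v * \<phi> (bs ! j))" for v
    using functional_sum[OF assms(2), of "\<lambda>j. coord scale bs j v" "\<lambda>j. bs ! j" "{..<length bs}"]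
      basis_expansion[OF assms(1)] by simp
  have "pullback scale bs cs T (lin_form bs \<phi>) =
      (\<Sum>j<length bs. \<Sum>k<length cs. Const (\<phi> (bs ! j)) * (Const (coord scale bs j (T (cs ! k))) * Var k))"
    by (simp add: pullback_def lin_form_def[of bs] Const.hom_sum Const.hom_mult)
       (simp add: lin_form_def sum_distrib_left)
  also have "\<dots> = (\<Sum>k<length cs. (\<Sum>j<length bs.
        Const (coord scale bs j (T (cs ! k)) * \<phi> (bs ! j))) * Var k)"
    by (subst sum.swap) (simp add: sum_distrib_right sum_distrib_left Const.c_mult mult_ac)
  also have "\<dots> = lin_form cs (\<phi> \<circ> T)"
    unfolding lin_form_def comp_def by (subst (2) exp) (simp add: Const_sum)
  finally show ?thesis .
qed

lemma pullback_comp: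
  assumes "ordered_basis scale bs" "ordered_basis scale cs" "Vector_Spaces.linear scale scale T"
  shows "pullback scale cs ds S (pullback scale bs cs T p) = pullback scale bs ds (T \<circ> S) p"
proof -
  have *: "pullback scale cs ds S (lin_form cs (coord scale bs i \<circ> T))
      = lin_form ds (coord scale bs i \<circ> (T \<circ> S))" for i
    using pullback_lin_form[OF assms(2) functional_comp[OF functional_coord[OF assms(1)] assms(3)]]
    by (simp only: comp_assoc)
  have "pullback scale cs ds S (pullback scale bs cs T p) =
      mpoly_hom Const (\<lambda>i. pullback scale cs ds S (lin_form cs (coord scale bs i \<circ> T))) p"
    by (simp add: pullback_def Const.hom_comp)
  also have "\<dots> = pullback scale bs ds (T \<circ> S) p"
    unfolding * by (simp add: pullback_def)
  finally show ?thesis .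
qed

lemma pullback_id:
  assumes "ordered_basis scale bs" "p \<in> poly_ring (length bs)"
  shows "pullback scale bs bs id p = p"
proof -
  have "lin_form bs (coord scale bs i \<circ> id) = Var i" if "i < length bs" for i
  proof -
    have "lin_form bs (coord scale bs i \<circ> id) = (\<Sum>j<length bs. if j = i then Var j else 0)"
      unfolding lin_form_def using that assms(1)
      by (intro sum.cong) (auto simp: coord_basis Const.c_0 Const.c_1)
    then show ?thesis using that by simp
  qed
  then have "pullback scale bs bs id p = mpoly_hom Const Var p"
    unfolding pullback_def by (intro mpoly_hom_cong[OF assms(2)])
  then show ?thesis by (simp add: mpoly_hom_Var)
qed

lemma eval_pullback:
  assumes "ordered_basis scale bs" "ordered_basis scale cs" "Vector_Spaces.linear scale scale T"
  shows "mpoly_hom (\<lambda>a. a) (\<lambda>i. coord scale cs i v) (pullback scale bs cs T p)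
    = mpoly_hom (\<lambda>a. a) (\<lambda>i. coord scale bs i (T v)) p"
proof -
  let ?ev = "mpoly_hom (\<lambda>a. a) (\<lambda>i. coord scale cs i v)"
  have "?ev (lin_form cs (coord scale bs i \<circ> T)) = coord scale bs i (T v)" for i
  proof -
    have f: "functional (coord scale bs i \<circ> T)"
      by (rule functional_comp[OF functional_coord[OF assms(1)] assms(3)])
    have "?ev (lin_form cs (coord scale bs i \<circ> T))
        = (\<Sum>k<length cs. coord scale cs k v * (coord scale bs i \<circ> T) (cs ! k))"
      by (simp add: lin_form_def eval.hom_sum eval.hom_mult mult.commute)
    also have "\<dots> = (coord scale bs i \<circ> T) (\<Sum>k<length cs. scale (coord scale cs k v) (cs ! k))"
      by (rule functional_sum[OF f, symmetric])
    finally show ?thesis by (simp add: basis_expansion[OF assms(2)])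
  qed
  then show ?thesis
    by (simp add: pullback_def eval.hom_comp)
qed

abbreviation automorphism :: "('b \<Rightarrow> 'b) \<Rightarrow> bool"
  where "automorphism T \<equiv> Vector_Spaces.linear scale scale T \<and> bij T"

lemma pullback_nonzero:
  assumes "ordered_basis scale bs" "ordered_basis scale cs" "automorphism T"
    and "p \<in> poly_ring (length bs)" "p \<noteq> 0"
  shows "pullback scale bs cs T p \<noteq> 0"
proof
  assume "pullback scale bs cs T p = 0"
  then have "pullback scale cs bs (Hilbert_Choice.inv T) (pullback scale bs cs T p) = 0" by simp
  moreover have "T \<circ> Hilbert_Choice.inv T = id"
    using assms(3) surj_iff bij_is_surj by blast
  ultimately show False
    using assms pullback_comp[OF assms(1,2)] pullback_id by simp
qed

lemma pullback_rat_Fract: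
  assumes B: "ordered_basis scale bs" "ordered_basis scale cs" and T: "automorphism T"
    and "p \<in> poly_ring (length bs)" "q \<in> poly_ring (length bs)" "q \<noteq> 0"
  shows "pullback_rat scale bs cs T (Fract p q)
    = Fract (pullback scale bs cs T p) (pullback scale bs cs T q)"
  unfolding pullback_rat_def
proof (rule the_equality)
  fix y
  assume "\<exists>p'\<in>poly_ring (length bs). \<exists>q'\<in>poly_ring (length bs). q' \<noteq> 0 \<and> Fract p q = Fract p' q' \<and>
       y = Fract (pullback scale bs cs T p') (pullback scale bs cs T q')"
  then obtain p' q' where *: "p' \<in> poly_ring (length bs)" "q' \<in> poly_ring (length bs)" "q' \<noteq> 0"
    "Fract p q = Fract p' q'" "y = Fract (pullback scale bs cs T p') (pullback scale bs cs T q')"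
    by blast
  then have "p * q' = p' * q" using assms(6) by (simp add: eq_fract)
  then have "pullback scale bs cs T p * pullback scale bs cs T q'
      = pullback scale bs cs T p' * pullback scale bs cs T q"
    by (simp flip: pullback_mult)
  then show "y = Fract (pullback scale bs cs T p) (pullback scale bs cs T q)"
    using * assms pullback_nonzero[OF B T] by (simp add: eq_fract)
qed (use assms in blast)

lemma rat_field_cases:
  assumes "x \<in> rat_field n"
  obtains p q where "x = Fract p q" "p \<in> poly_ring n" "q \<in> poly_ring n" "q \<noteq> 0"
  using assms by (auto simp: rat_field_def)

lemma rat_field_Fract: "p \<in> poly_ring n \<Longrightarrow> q \<in> poly_ring n \<Longrightarrow> q \<noteq> 0 \<Longrightarrow> Fract p q \<in> rat_field n"
  by (auto simp: rat_field_def)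

lemma rat_field_poly: "p \<in> poly_ring n \<Longrightarrow> Fract p 1 \<in> rat_field n"
  by (intro rat_field_Fract) simp_all

context
  fixes bs cs :: "'b list" and T :: "'b \<Rightarrow> 'b"
  assumes B: "ordered_basis scale bs" "ordered_basis scale cs" and T: "automorphism T"
begin

lemma pullback_rat_closed:
  "x \<in> rat_field (length bs) \<Longrightarrow> pullback_rat scale bs cs T x \<in> rat_field (length cs)"
  by (erule rat_field_cases)
     (auto simp: pullback_rat_Fract[OF B T] pullback_nonzero[OF B T]
       intro!: rat_field_Fract pullback_poly_ring)

lemma pullback_rat_add:
  assumes "x \<in> rat_field (length bs)" "y \<in> rat_field (length bs)"
  shows "x + y \<in> rat_field (length bs)"
    and "pullback_rat scale bs cs T (x + y) = pullback_rat scale bs cs T x + pullback_rat scale bs cs T y"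
  using assms
  by (auto elim!: rat_field_cases intro!: rat_field_Fract
      simp: pullback_rat_Fract[OF B T] pullback_nonzero[OF B T] pullback_add pullback_mult
        poly_ring_add poly_ring_mult)

lemma pullback_rat_mult:
  assumes "x \<in> rat_field (length bs)" "y \<in> rat_field (length bs)"
  shows "x * y \<in> rat_field (length bs)"
    and "pullback_rat scale bs cs T (x * y) = pullback_rat scale bs cs T x * pullback_rat scale bs cs T y"
  using assms
  by (auto elim!: rat_field_cases intro!: rat_field_Fract
      simp: pullback_rat_Fract[OF B T] pullback_mult poly_ring_mult)

lemma pullback_rat_poly:
  "p \<in> poly_ring (length bs) \<Longrightarrow>
    pullback_rat scale bs cs T (Fract p 1) = Fract (pullback scale bs cs T p) 1"
  by (simp add: pullback_rat_Fract[OF B T])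

lemma pullback_rat_sum:
  assumes "\<And>a. a \<in> A \<Longrightarrow> f a \<in> rat_field (length bs)"
  shows "sum f A \<in> rat_field (length bs)"
    and "pullback_rat scale bs cs T (sum f A) = (\<Sum>a\<in>A. pullback_rat scale bs cs T (f a))"
proof -
  have 0: "0 \<in> rat_field (length bs)" "pullback_rat scale bs cs T 0 = 0"
    using rat_field_poly[of 0 "length bs"] pullback_rat_poly[of 0]
    by (simp_all add: Zero_fract_def poly_ring_def)
  have "sum f A \<in> rat_field (length bs) \<and>
    pullback_rat scale bs cs T (sum f A) = (\<Sum>a\<in>A. pullback_rat scale bs cs T (f a))"
    using assms by (induction A rule: infinite_finite_induct) (simp_all add: 0 pullback_rat_add)
  then show "sum f A \<in> rat_field (length bs)"
    and "pullback_rat scale bs cs T (sum f A) = (\<Sum>a\<in>A. pullback_rat scale bs cs T (f a))"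
    by auto
qed

end

lemma pullback_rat_comp:
  assumes "ordered_basis scale bs" "ordered_basis scale cs" "ordered_basis scale ds"
    and "automorphism T" "automorphism S" "x \<in> rat_field (length bs)"
  shows "pullback_rat scale cs ds S (pullback_rat scale bs cs T x) = pullback_rat scale bs ds (T \<circ> S) x"
proof -
  have TS: "automorphism (T \<circ> S)"
    using assms by (auto simp: Vector_Spaces.linear_iff intro: bij_comp)
  obtain p q where "x = Fract p q" "p \<in> poly_ring (length bs)" "q \<in> poly_ring (length bs)" "q \<noteq> 0"
    using assms(6) by (rule rat_field_cases)
  then show ?thesis
    using assms TS by (simp add: pullback_rat_Fract pullback_comp pullback_poly_ring pullback_nonzero)
qed

lemma pullback_rat_id:
  assumes "ordered_basis scale bs" "x \<in> rat_field (length bs)"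
  shows "pullback_rat scale bs bs id x = x"
proof -
  have "automorphism id" by (simp add: Vector_Spaces.linear_iff vector_space_axioms)
  then show ?thesis
    using assms by (auto elim!: rat_field_cases simp: pullback_rat_Fract pullback_id)
qed

lemma finite_dim_iff: "finite_dim scale \<longleftrightarrow> (\<exists>bs. ordered_basis scale bs)"
proof
  assume "finite_dim scale"
  then obtain B where B: "finite B" "span B = UNIV" by (auto simp: finite_dim_def)
  obtain C where C: "C \<subseteq> B" "independent C" "B \<subseteq> span C"
    by (rule maximal_independent_subset)
  have "span C = UNIV" using B C span_minimal[OF C(3)] by auto
  moreover obtain bs where "set bs = C" "distinct bs"
    using finite_distinct_list[of C] finite_subset[OF C(1) B(1)] by auto
  ultimately show "\<exists>bs. ordered_basis scale bs"
    using C by (auto simp: ordered_basis_def)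
qed (auto simp: finite_dim_def ordered_basis_def)

end


section \<open>Independence of the basis\<close>

sublocale linear_representation \<subseteq> coordinates scale ..

context linear_representation
begin

lemma automorphism_rho: "g \<in> carrier G \<Longrightarrow> automorphism (\<rho> g)"
  using bij_prop0[of g] linear_rho by (simp add: Bij_def)

lemma spans_in_degree_change_basis:
  assumes B: "ordered_basis scale bs" and C: "ordered_basis scale cs"
    and d: "spans_in_degree G scale \<rho> bs d"
  shows "spans_in_degree G scale \<rho> cs d"
proof -
  have auto_id: "automorphism id" by (simp add: Vector_Spaces.linear_iff vector_space_axioms)
  let ?K = "\<lambda>bs :: 'v list. rat_field (length bs) :: 'k mpoly fract set"
    and ?P = "\<lambda>bs :: 'v list. (\<lambda>p. Fract p 1) ` poly_deg_le (length bs) d :: 'k mpoly fract set"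
  define f where "f = pullback_rat scale bs cs id"
  define h where "h = pullback_rat scale cs bs id"
  have h_f: "h (f x) = x" if "x \<in> ?K bs" for x
    using that B C auto_id by (simp add: f_def h_def pullback_rat_comp pullback_rat_id)
  have f_h: "f (h x) = x" if "x \<in> ?K cs" for x
    using that B C auto_id by (simp add: f_def h_def pullback_rat_comp pullback_rat_id)
  have h_closed: "h x \<in> ?K bs" if "x \<in> ?K cs" for x
    using that B C auto_id by (simp add: h_def pullback_rat_closed)
  have f_inv: "f x \<in> inv_field G scale \<rho> cs" if x: "x \<in> inv_field G scale \<rho> bs" for x
  proof -
    have xK: "x \<in> ?K bs" using x by (simp add: inv_field_def)
    have "act_rat G scale \<rho> cs g (f x) = f x" if "g \<in> carrier G" for g
    proof -
      let ?T = "\<rho> (inv g)"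
      have T: "automorphism ?T"
        using that group_hom by (intro automorphism_rho) (simp add: group_hom_def group.inv_closed)
      have "act_rat G scale \<rho> cs g (f x) = pullback_rat scale bs cs ?T x"
        using B C xK T auto_id by (simp add: act_rat_def f_def pullback_rat_comp)
      also have "\<dots> = f (act_rat G scale \<rho> bs g x)"
        using B C xK T auto_id by (simp add: act_rat_def f_def pullback_rat_comp)
      also have "act_rat G scale \<rho> bs g x = x" using x that by (simp add: inv_field_def)
      finally show ?thesis .
    qed
    then show ?thesis
      using pullback_rat_closed[OF B C auto_id xK] by (simp add: inv_field_def f_def)
  qed
  have P_K: "?P bs \<subseteq> ?K bs" for bs
    by (auto simp: poly_deg_le_def intro: rat_field_poly)
  have f_P: "f ` ?P bs \<subseteq> ?P cs"
    using pullback_deg_le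
    by (auto simp: f_def pullback_rat_poly[OF B C auto_id] poly_deg_le_def[of "length bs"])
      (force simp: poly_deg_le_def)
  have "span_over (inv_field G scale \<rho> cs) (?P cs) \<subseteq> ?K cs"
  proof
    fix y assume "y \<in> span_over (inv_field G scale \<rho> cs) (?P cs)"
    then obtain S c where S: "finite S" "S \<subseteq> ?P cs" "c ` S \<subseteq> inv_field G scale \<rho> cs"
      and y: "y = (\<Sum>a\<in>S. c a * a)" by (auto simp: span_over_def)
    have "c a * a \<in> ?K cs" if "a \<in> S" for a
    proof (rule pullback_rat_mult(1)[OF C C auto_id])
      show "c a \<in> ?K cs" using S that by (auto simp: inv_field_def)
      show "a \<in> ?K cs" using S P_K[of cs] that by blast
    qed
    then show "y \<in> ?K cs" unfolding y by (rule pullback_rat_sum(1)[OF C C auto_id])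
  qed
  moreover have "?K cs \<subseteq> span_over (inv_field G scale \<rho> cs) (?P cs)"
  proof
    fix y assume y: "y \<in> ?K cs"
    then have "h y \<in> span_over (inv_field G scale \<rho> bs) (?P bs)"
      using d h_closed by (simp add: spans_in_degree_def)
    then obtain S c where S: "finite S" "S \<subseteq> ?P bs" "c ` S \<subseteq> inv_field G scale \<rho> bs"
      and hy: "h y = (\<Sum>a\<in>S. c a * a)" by (auto simp: span_over_def)
    have SK: "a \<in> ?K bs" "c a \<in> ?K bs" if "a \<in> S" for a
      using S P_K[of bs] that by (blast, auto simp: inv_field_def)
    have "y = f (h y)" using y f_h by simp
    also have "\<dots> = (\<Sum>a\<in>S. f (c a) * f a)"
      unfolding hy f_def using SK pullback_rat_mult[OF B C auto_id]
      by (subst pullback_rat_sum(2)[OF B C auto_id]) auto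
    also have "\<dots> = (\<Sum>b\<in>f ` S. f (c (h b)) * b)"
    proof -
      have "inj_on f S" using h_f SK by (intro inj_on_inverseI[of S h]) auto
      then show ?thesis using h_f SK by (simp add: sum.reindex)
    qed
    finally have "y = (\<Sum>b\<in>f ` S. f (c (h b)) * b)" .
    moreover have "finite (f ` S)" using S by simp
    moreover have "f ` S \<subseteq> ?P cs" using image_mono[OF S(2)] f_P by (rule subset_trans)
    moreover have "(\<lambda>b. f (c (h b))) ` f ` S \<subseteq> inv_field G scale \<rho> cs"
      using S f_inv h_f SK by auto
    ultimately show "y \<in> span_over (inv_field G scale \<rho> cs) (?P cs)"
      unfolding span_over_def mem_Collect_eq
      by (intro exI[of _ "f ` S"] exI[of _ "\<lambda>b. f (c (h b))"]) simp
  qed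
  ultimately show ?thesis by (auto simp: spans_in_degree_def)
qed

lemma D_span_eq:
  assumes "ordered_basis scale bs"
  shows "D_span G scale \<rho> = (LEAST d. spans_in_degree G scale \<rho> bs d)"
proof -
  have "ordered_basis scale (SOME bs. ordered_basis scale bs)"
    using assms by (rule someI)
  then have "spans_in_degree G scale \<rho> (SOME bs. ordered_basis scale bs) d
      \<longleftrightarrow> spans_in_degree G scale \<rho> bs d" for d
    using assms spans_in_degree_change_basis by blast
  then show ?thesis by (simp add: D_span_def)
qed

end

end

theory Submission
  imports Defs "HOL-Computational_Algebra.Polynomial"
begin

text \<open>Invariants of \<open>G\<close> are invariants of \<open>H\<close>, so a degree that spans over \<open>k(V)\<^sup>G\<close> also spans over
  \<open>k(V)\<^sup>H\<close>. What remains is that some degree spans for \<open>G\<close>, since otherwise the minimum would be a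
  junk value. Multiplying numerator and denominator by the conjugates of the denominator makes
  every denominator invariant, so monomials span. Each coordinate function is a root of the monic
  polynomial \<open>\<Prod>g. (t - g x)\<close> with invariant coefficients, so its powers lie in the span of those
  below \<open>|G|\<close>; hence degree \<open>n (|G| - 1)\<close> spans.\<close>

section \<open>Spans over a subring\<close>

lemma span_over_mono: "F \<subseteq> F' \<Longrightarrow> span_over F A \<subseteq> span_over F' A"
  unfolding span_over_def by blast

text \<open>An element of \<open>span_over F A\<close> is a sum over a finite set of distinct
  generators with one coefficient each. These closure properties of \<open>F\<close> make such sums
  stable under addition, scaling and multiplication.\<close>

locale coeff_subring =
  fixes F :: "'a::comm_ring_1 set"
  assumes F_0: "0 \<in> F" and F_1: "1 \<in> F"
    and F_add: "\<And>x y. x \<in> F \<Longrightarrow> y \<in> F \<Longrightarrow> x + y \<in> F"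
    and F_mult: "\<And>x y. x \<in> F \<Longrightarrow> y \<in> F \<Longrightarrow> x * y \<in> F"
begin

lemma span_over_base: "a \<in> A \<Longrightarrow> a \<in> span_over F A"
  unfolding span_over_def mem_Collect_eq
  using F_1 by (intro exI[of _ "{a}"] exI[of _ "\<lambda>_. 1"]) auto

lemma span_over_0: "0 \<in> span_over F A"
  unfolding span_over_def mem_Collect_eq by (intro exI[of _ "{}"]) auto

lemma span_over_add:
  assumes "x \<in> span_over F A" "y \<in> span_over F A"
  shows "x + y \<in> span_over F A"
proof -
  obtain S c where S: "finite S" "S \<subseteq> A" "c ` S \<subseteq> F" "x = (\<Sum>a\<in>S. c a * a)"
    using assms(1) by (auto simp: span_over_def)
  obtain T d where T: "finite T" "T \<subseteq> A" "d ` T \<subseteq> F" "y = (\<Sum>a\<in>T. d a * a)"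
    using assms(2) by (auto simp: span_over_def)
  \<comment> \<open>A generator may occur in both sums, so the two coefficient functions are
    extended by 0 to \<open>S \<union> T\<close> and added.\<close>
  define e where "e a = (if a \<in> S then c a else 0) + (if a \<in> T then d a else 0)" for a
  have "x = (\<Sum>a\<in>S \<union> T. (if a \<in> S then c a else 0) * a)"
    unfolding S(4) using S(1) T(1) by (intro sum.mono_neutral_cong_left) auto
  moreover have "y = (\<Sum>a\<in>S \<union> T. (if a \<in> T then d a else 0) * a)"
    unfolding T(4) using S(1) T(1) by (intro sum.mono_neutral_cong_left) auto
  ultimately have "x + y = (\<Sum>a\<in>S \<union> T. e a * a)"
    by (simp add: e_def distrib_right sum.distrib)
  moreover have "e ` (S \<union> T) \<subseteq> F"
    using S(3) T(3) F_0 by (auto simp: e_def image_subset_iff intro!: F_add)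
  ultimately show ?thesis
    unfolding span_over_def mem_Collect_eq using S(1,2) T(1,2)
    by (intro exI[of _ "S \<union> T"] exI[of _ e]) auto
qed

lemma span_over_sum: "(\<And>i. i \<in> I \<Longrightarrow> f i \<in> span_over F A) \<Longrightarrow> sum f I \<in> span_over F A"
  by (induction I rule: infinite_finite_induct) (auto intro: span_over_0 span_over_add)

lemma span_over_scale:
  assumes "r \<in> F" "x \<in> span_over F A"
  shows "r * x \<in> span_over F A"
proof -
  obtain S c where S: "finite S" "S \<subseteq> A" "c ` S \<subseteq> F" "x = (\<Sum>a\<in>S. c a * a)"
    using assms(2) by (auto simp: span_over_def)
  then have "r * x = (\<Sum>a\<in>S. (r * c a) * a)"
    by (simp add: sum_distrib_left mult.assoc)
  moreover have "(\<lambda>a. r * c a) ` S \<subseteq> F"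
    using S(3) assms(1) F_mult by auto
  ultimately show ?thesis
    unfolding span_over_def mem_Collect_eq using S(1,2)
    by (intro exI[of _ S] exI[of _ "\<lambda>a. r * c a"]) auto
qed

lemma span_over_mult:
  assumes "x \<in> span_over F A" "y \<in> span_over F B"
    and "\<And>a b. a \<in> A \<Longrightarrow> b \<in> B \<Longrightarrow> a * b \<in> C"
  shows "x * y \<in> span_over F C"
proof -
  obtain S c where S: "S \<subseteq> A" "c ` S \<subseteq> F" "x = (\<Sum>a\<in>S. c a * a)"
    using assms(1) by (auto simp: span_over_def)
  obtain T d where T: "T \<subseteq> B" "d ` T \<subseteq> F" "y = (\<Sum>b\<in>T. d b * b)"
    using assms(2) by (auto simp: span_over_def)
  \<comment> \<open>Different pairs can have the same product \<open>a * b\<close>, so the double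
    sum is not itself a sum over distinct generators. Closure under sums and scaling takes care of
    the collisions.\<close>
  have "x * y = (\<Sum>a\<in>S. \<Sum>b\<in>T. (c a * d b) * (a * b))"
    unfolding S T sum_product by (simp add: mult_ac)
  also have "\<dots> \<in> span_over F C"
    using S(1,2) T(1,2)
    by (intro span_over_sum span_over_scale span_over_base[of _ C] F_mult assms(3)) auto
  finally show ?thesis .
qed

end


section \<open>The field of rational functions and its invariants\<close>

context coordinates
begin

lemma rat_field_0: "0 \<in> rat_field n"
  and rat_field_1: "1 \<in> rat_field n"
  using rat_field_poly[of 0 n] rat_field_poly[of 1 n]
  by (simp_all add: Zero_fract_def One_fract_def poly_ring_def)

lemma rat_field_add: "x \<in> rat_field n \<Longrightarrow> y \<in> rat_field n \<Longrightarrow> x + y \<in> rat_field n"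
  by (auto elim!: rat_field_cases intro!: rat_field_Fract poly_ring_add poly_ring_mult)

lemma rat_field_mult: "x \<in> rat_field n \<Longrightarrow> y \<in> rat_field n \<Longrightarrow> x * y \<in> rat_field n"
  by (auto elim!: rat_field_cases intro!: rat_field_Fract poly_ring_mult)

lemma rat_field_uminus: "x \<in> rat_field n \<Longrightarrow> - x \<in> rat_field n"
  by (auto elim!: rat_field_cases intro!: rat_field_Fract simp: poly_ring_def)

lemma rat_field_inverse: "x \<in> rat_field n \<Longrightarrow> inverse x \<in> rat_field n"
proof (cases "x = 0")
  case False
  then show "x \<in> rat_field n \<Longrightarrow> inverse x \<in> rat_field n"
    by (auto elim!: rat_field_cases intro!: rat_field_Fract simp: Zero_fract_def eq_fract)
qed (simp add: rat_field_0)

lemma rat_field_sum: "(\<And>i. i \<in> I \<Longrightarrow> f i \<in> rat_field n) \<Longrightarrow> sum f I \<in> rat_field n"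
  by (induction I rule: infinite_finite_induct) (auto intro: rat_field_0 rat_field_add)

lemma rat_field_prod: "(\<And>i. i \<in> I \<Longrightarrow> f i \<in> rat_field n) \<Longrightarrow> prod f I \<in> rat_field n"
  by (induction I rule: infinite_finite_induct) (auto intro: rat_field_1 rat_field_mult)

lemma span_over_rat_field:
  assumes "F \<subseteq> rat_field n" "A \<subseteq> rat_field n"
  shows "span_over F A \<subseteq> rat_field n"
  using assms by (auto simp: span_over_def intro!: rat_field_sum rat_field_mult)

lemma deg_le_in_rat_field: "(\<lambda>p. Fract p 1) ` poly_deg_le n d \<subseteq> rat_field n"
  by (auto simp: poly_deg_le_def intro: rat_field_poly)

end

section \<open>Polynomials embedded among the fractions\<close>

lemma poly_ring_prod: "(\<And>i. i \<in> I \<Longrightarrow> f i \<in> poly_ring n) \<Longrightarrow> prod f I \<in> poly_ring n"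
  by (induction I rule: infinite_finite_induct) (auto intro: poly_ring_mult)

text \<open>This orientation splits a fraction, against the simp rule \<open>mult_fract\<close> that
  merges two; hence \<open>mult_fract\<close> is deleted wherever it serves as a rewrite
  rule.\<close>

lemma Fract_1_mult: "Fract (p * q) 1 = Fract p 1 * Fract q 1"
  by simp

lemma Fract_1_sum: "Fract (sum f A) 1 = (\<Sum>x\<in>A. Fract (f x) 1)"
proof (induction A rule: infinite_finite_induct)
  case (insert x A)
  have "Fract (f x + sum f A) 1 = Fract (f x) 1 + Fract (sum f A) 1" by simp
  then show ?case using insert by (simp del: add_fract)
qed (simp_all add: Zero_fract_def)

lemma Fract_1_prod: "Fract (prod f A) 1 = (\<Prod>x\<in>A. Fract (f x) 1)"
  by (induction A rule: infinite_finite_induct) (simp_all add: One_fract_def Fract_1_mult del: mult_fract)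

lemma Fract_1_power: "Fract (p ^ e) 1 = Fract p 1 ^ e"
  by (induction e) (simp_all add: One_fract_def Fract_1_mult del: mult_fract)

section \<open>The action of G on k(V) by field automorphisms, and its invariants\<close>

context linear_representation
begin

lemma one_in_carrier: "\<one> \<in> carrier G"
  using group_hom by (simp add: group_hom_def group.is_monoid)

context
  fixes bs :: "'v list"
  assumes B: "ordered_basis scale bs"
begin

text \<open>In the coordinates of \<open>bs\<close>, \<open>K\<close> is k(V) and \<open>F\<close>
  is k(V)^G. The spans \<open>M d\<close> form a multiplicative filtration, see
  \<open>deg_le_span_mult\<close>.\<close>

abbreviation "K \<equiv> rat_field (length bs) :: 'k mpoly fract set"
abbreviation "F \<equiv> inv_field G scale \<rho> bs"
abbreviation "act \<equiv> act_rat G scale \<rho> bs"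
abbreviation "M d \<equiv> span_over F ((\<lambda>p. Fract p 1) ` poly_deg_le (length bs) d)"

lemma automorphism_rho_inv: "g \<in> carrier G \<Longrightarrow> automorphism (\<rho> (inv g))"
  using group_hom by (intro automorphism_rho) (simp add: group_hom_def group.inv_closed)

lemma act_closed: "g \<in> carrier G \<Longrightarrow> x \<in> K \<Longrightarrow> act g x \<in> K"
  unfolding act_rat_def by (rule pullback_rat_closed[OF B B automorphism_rho_inv])

lemma act_add: "g \<in> carrier G \<Longrightarrow> x \<in> K \<Longrightarrow> y \<in> K \<Longrightarrow> act g (x + y) = act g x + act g y"
  unfolding act_rat_def by (rule pullback_rat_add(2)[OF B B automorphism_rho_inv])

lemma act_mult: "g \<in> carrier G \<Longrightarrow> x \<in> K \<Longrightarrow> y \<in> K \<Longrightarrow> act g (x * y) = act g x * act g y"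
  unfolding act_rat_def by (rule pullback_rat_mult(2)[OF B B automorphism_rho_inv])

lemma act_Fract_1:
  assumes "g \<in> carrier G" "p \<in> poly_ring (length bs)"
  shows "act g (Fract p 1) = Fract (pullback scale bs bs (\<rho> (inv g)) p) 1"
  unfolding act_rat_def by (rule pullback_rat_poly[OF B B automorphism_rho_inv[OF assms(1)] assms(2)])

lemma act_0: "g \<in> carrier G \<Longrightarrow> act g 0 = 0"
  and act_1: "g \<in> carrier G \<Longrightarrow> act g 1 = 1"
  using act_Fract_1[of g 0] act_Fract_1[of g 1]
  by (simp_all add: Zero_fract_def One_fract_def poly_ring_def)

lemma act_uminus:
  assumes "g \<in> carrier G" "x \<in> K"
  shows "act g (- x) = - act g x"
proof -
  have "act g x + act g (- x) = 0"
    using act_add[OF assms rat_field_uminus[OF assms(2)]] act_0[OF assms(1)] by simp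
  then show ?thesis
    by (simp add: eq_neg_iff_add_eq_0 add.commute)
qed

lemma act_inverse:
  assumes "g \<in> carrier G" "x \<in> K"
  shows "act g (inverse x) = inverse (act g x)"
proof (cases "x = 0")
  case False
  then have "act g x * act g (inverse x) = 1"
    using act_mult[OF assms rat_field_inverse[OF assms(2)]] act_1[OF assms(1)] by simp
  then show ?thesis
    by (rule inverse_unique[symmetric])
qed (simp add: act_0 assms)

lemma act_prod:
  "g \<in> carrier G \<Longrightarrow> (\<And>i. i \<in> I \<Longrightarrow> f i \<in> K) \<Longrightarrow> act g (prod f I) = (\<Prod>i\<in>I. act g (f i))"
  by (induction I rule: infinite_finite_induct) (auto simp: act_1 act_mult rat_field_prod)

text \<open>Pullback reverses composition and inversion reverses products in \<open>G\<close>; the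
  two reversals cancel, giving a left action.\<close>

lemma act_act:
  assumes "g \<in> carrier G" "h \<in> carrier G" "x \<in> K"
  shows "act g (act h x) = act (g \<otimes> h) x"
proof -
  interpret group G using group_hom by (simp add: group_hom_def)
  have "act g (act h x) = pullback_rat scale bs bs (\<rho> (inv h) \<circ> \<rho> (inv g)) x"
    unfolding act_rat_def
    using assms automorphism_rho_inv by (intro pullback_rat_comp[OF B B B]) auto
  also have "\<rho> (inv h) \<circ> \<rho> (inv g) = \<rho> (inv (g \<otimes> h))"
    using assms by (auto simp: inv_mult_group composition_rule)
  finally show ?thesis by (simp add: act_rat_def)
qed

lemma act_one:
  assumes "x \<in> K"
  shows "act \<one> x = x"
proof -
  interpret group G using group_hom by (simp add: group_hom_def)
  have "\<rho> \<one> = id" using id_eq_one by (auto simp: fun_eq_iff)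
  then show ?thesis
    using pullback_rat_id[OF B assms] by (simp add: act_rat_def)
qed

lemma inv_field_subset: "F \<subseteq> K"
  by (auto simp: inv_field_def)

lemma inv_field_0: "0 \<in> F"
  and inv_field_1: "1 \<in> F"
  and inv_field_add: "x \<in> F \<Longrightarrow> y \<in> F \<Longrightarrow> x + y \<in> F"
  and inv_field_mult: "x \<in> F \<Longrightarrow> y \<in> F \<Longrightarrow> x * y \<in> F"
  and inv_field_uminus: "x \<in> F \<Longrightarrow> - x \<in> F"
  and inv_field_inverse: "x \<in> F \<Longrightarrow> inverse x \<in> F"
  by (auto simp: inv_field_def act_0 act_1 act_add act_mult act_uminus act_inverse
      rat_field_0 rat_field_1 rat_field_add rat_field_mult rat_field_uminus rat_field_inverse)

interpretation inv_field: coeff_subring F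
  by unfold_locales (simp_all add: inv_field_0 inv_field_1 inv_field_add inv_field_mult)

lemma deg_le_in_span: "p \<in> poly_deg_le (length bs) d \<Longrightarrow> Fract p 1 \<in> M d"
  by (intro inv_field.span_over_base imageI)

lemma deg_le_span_mult: "x \<in> M d \<Longrightarrow> y \<in> M e \<Longrightarrow> x * y \<in> M (d + e)"
  by (erule inv_field.span_over_mult) (auto intro: deg_le_mult)

text \<open>Used to reindex products over the group: applying \<open>h\<close> to a product over all
  conjugates merely permutes the factors.\<close>

lemma bij_betw_left_mult:
  assumes "h \<in> carrier G"
  shows "bij_betw (\<lambda>g. h \<otimes> g) (carrier G) (carrier G)"
proof -
  interpret group G using group_hom by (simp add: group_hom_def)
  show ?thesis
    using assms inv_solve_left
    by (intro bij_betwI[where g = "\<lambda>g. inv h \<otimes> g"]) (auto simp: m_assoc[symmetric])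
qed

text \<open>The norm of \<open>x\<close> is fixed because \<open>h\<close> sends the factor of
  \<open>g\<close> to that of \<open>h \<otimes> g\<close>. Over an infinite carrier the product is
  1 by convention, which is invariant too.\<close>

lemma norm_in_inv_field:
  assumes "x \<in> K"
  shows "(\<Prod>g\<in>carrier G. act g x) \<in> F"
proof -
  have "act h (\<Prod>g\<in>carrier G. act g x) = (\<Prod>g\<in>carrier G. act g x)" if h: "h \<in> carrier G" for h
  proof -
    have "act h (\<Prod>g\<in>carrier G. act g x) = (\<Prod>g\<in>carrier G. act (h \<otimes> g) x)"
      using h assms by (simp add: act_prod act_closed act_act)
    also have "\<dots> = (\<Prod>g\<in>carrier G. act g x)"
      by (rule prod.reindex_bij_betw[OF bij_betw_left_mult[OF h]])
    finally show ?thesis .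
  qed
  then show ?thesis
    using assms by (auto simp: inv_field_def intro!: rat_field_prod act_closed)
qed


section \<open>Existence of a spanning degree\<close>

text \<open>Multiplying by \<open>[:y a, 1:]\<close> produces coefficients that are sums and
  products of earlier ones, and the action respects both. Membership in \<open>K\<close> is proved
  alongside because \<open>act_add\<close> and \<open>act_mult\<close> require it.\<close>

lemma act_coeff_prod_linear:
  assumes "h \<in> carrier G" "finite A" "\<And>a. a \<in> A \<Longrightarrow> y a \<in> K"
  shows "coeff (\<Prod>a\<in>A. [:y a, 1:]) k \<in> K \<and>
    act h (coeff (\<Prod>a\<in>A. [:y a, 1:]) k) = coeff (\<Prod>a\<in>A. [:act h (y a), 1:]) k"
  using assms(2,3)
proof (induction A arbitrary: k rule: finite_induct)
  case empty
  then show ?case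
    using assms(1) by (cases k) (auto simp: act_0 act_1 rat_field_0 rat_field_1)
next
  case (insert a A)
  then show ?case
    using assms(1)
    by (cases k) (auto simp: act_add act_mult rat_field_add rat_field_mult)
qed

lemma char_poly_coeff_invariant:
  assumes "x \<in> K" "finite (carrier G)"
  shows "coeff (\<Prod>g\<in>carrier G. [:act g x, 1:]) k \<in> F"
proof -
  let ?P = "\<Prod>g\<in>carrier G. [:act g x, 1:]"
  have *: "coeff ?P k \<in> K \<and>
    act h (coeff ?P k) = coeff (\<Prod>g\<in>carrier G. [:act h (act g x), 1:]) k" if "h \<in> carrier G" for h
    using that assms by (intro act_coeff_prod_linear) (auto intro: act_closed)
  have "act h (coeff ?P k) = coeff ?P k" if h: "h \<in> carrier G" for h
  proof -
    have "(\<Prod>g\<in>carrier G. [:act h (act g x), 1:]) = (\<Prod>g\<in>carrier G. [:act (h \<otimes> g) x, 1:])"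
      using h assms by (simp add: act_act)
    also have "\<dots> = ?P"
      by (rule prod.reindex_bij_betw[OF bij_betw_left_mult[OF h]])
    finally show ?thesis using *[OF h] by simp
  qed
  then show ?thesis using * one_in_carrier by (auto simp: inv_field_def)
qed

text \<open>Every rational function is integral over the invariants, with a monic equation of degree
  \<open>card (carrier G)\<close>; solving it for the top power gives the coefficients
  \<open>c\<close>.\<close>

lemma power_card_in_span:
  assumes "x \<in> K" "finite (carrier G)"
  obtains c where "range c \<subseteq> F" "x ^ card (carrier G) = (\<Sum>i<card (carrier G). c i * x ^ i)"
proof
  \<comment> \<open>The conjugates of \<open>- x\<close> are used because \<open>[:a, 1:]\<close> is
    t + a: the factor for \<open>g\<close> is then t - g x, and the one for \<open>\<one>\<close>
    vanishes at \<open>x\<close>.\<close>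
  define P where "P = (\<Prod>g\<in>carrier G. [:act g (- x), 1:])"
  have mx: "- x \<in> K" using assms(1) by (rule rat_field_uminus)
  show "range (\<lambda>i. - coeff P i) \<subseteq> F"
    using char_poly_coeff_invariant[OF mx assms(2)] by (auto simp: P_def intro: inv_field_uminus)
  have deg: "degree P = card (carrier G)"
    by (simp add: P_def degree_prod_eq_sum_degree)
  have lead: "coeff P (card (carrier G)) = 1"
    using lead_coeff_prod[of "\<lambda>g. [:act g (- x), 1:]" "carrier G"] by (simp add: P_def[symmetric] deg)
  have "poly P x = 0"
    using assms(2) one_in_carrier act_one[OF mx] by (force simp: P_def poly_prod)
  then have "(\<Sum>i<card (carrier G). coeff P i * x ^ i) + x ^ card (carrier G) = 0"
    by (simp add: poly_altdef deg lead lessThan_Suc_atMost[symmetric])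
  then show "x ^ card (carrier G) = (\<Sum>i<card (carrier G). - coeff P i * x ^ i)"
    by (simp add: sum_negf eq_neg_iff_add_eq_0 add.commute)
qed

text \<open>Strong induction on the exponent: small powers are polynomials of admissible degree, and
  the monic equation reduces larger ones.\<close>

lemma power_Var_in_span:
  assumes "finite (carrier G)" "i < length bs"
  shows "Fract (Var i) 1 ^ e \<in> M (card (carrier G) - 1)"
proof (induction e rule: less_induct)
  case (less e)
  let ?x = "Fract (Var i) 1 :: 'k mpoly fract"
  have V: "Var i \<in> poly_deg_le (length bs) 1" by (rule deg_le_Var) fact
  show ?case
  proof (cases "e < card (carrier G)")
    case True
    then have "Var i ^ e \<in> poly_deg_le (length bs) (card (carrier G) - 1)"
      using deg_le_power[OF V, of e] by (auto intro: deg_le_mono)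
    then show ?thesis
      unfolding Fract_1_power[symmetric] by (rule deg_le_in_span)
  next
    case False
    have "?x \<in> K" using V by (intro rat_field_poly) (auto simp: poly_deg_le_def)
    then obtain c where c: "range c \<subseteq> F" "?x ^ card (carrier G) = (\<Sum>j<card (carrier G). c j * ?x ^ j)"
      using power_card_in_span assms(1) by blast
    \<comment> \<open>After substitution every exponent \<open>j + (e - card (carrier G))\<close> is
      below \<open>e\<close>, as \<open>j < card (carrier G)\<close>, so the induction hypothesis
      covers each term.\<close>
    have "?x ^ e = ?x ^ card (carrier G) * ?x ^ (e - card (carrier G))"
      using False by (simp flip: power_add)
    also have "\<dots> = (\<Sum>j<card (carrier G). c j * ?x ^ (j + (e - card (carrier G))))"
      by (simp add: c(2) sum_distrib_right power_add mult.assoc)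
    also have "\<dots> \<in> M (card (carrier G) - 1)"
      using c(1) False by (intro inv_field.span_over_sum inv_field.span_over_scale less.IH) auto
    finally show ?thesis .
  qed
qed

text \<open>Each of the \<open>length bs\<close> variables contributes at most
  \<open>card (carrier G) - 1\<close> to the degree bound, whatever its exponent.\<close>

lemma poly_in_span:
  assumes "finite (carrier G)" "p \<in> poly_ring (length bs)"
  shows "Fract p 1 \<in> M (length bs * (card (carrier G) - 1))"
proof -
  let ?N = "card (carrier G) - 1"
  have prod: "(\<Prod>i<l. Fract (Var i) 1 ^ e i) \<in> M (l * ?N)" if "l \<le> length bs" for e l
    using that
  proof (induction l)
    case 0
    have "(1 :: 'k mpoly fract) = Fract 1 1" by (simp add: One_fract_def)
    then show ?case using deg_le_in_span[of 1 0] by simp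
  next
    case (Suc l)
    have "(\<Prod>i<l. Fract (Var i) 1 ^ e i) * Fract (Var l) 1 ^ e l \<in> M (l * ?N + ?N)"
    proof (rule deg_le_span_mult)
      show "(\<Prod>i<l. Fract (Var i) 1 ^ e i) \<in> M (l * ?N)" using Suc by simp
      show "Fract (Var l) 1 ^ e l \<in> M ?N"
        using Suc assms(1) by (intro power_Var_in_span) auto
    qed
    then show ?case by (simp add: add.commute)
  qed
  \<comment> \<open>Substituting the variables for themselves expands \<open>p\<close> into its
    terms. Each monomial is taken over all variables, with exponent 0 allowed, so that one bound
    serves all terms.\<close>
  have "p = mpoly_hom Const Var p" by (simp add: mpoly_hom_Var)
  also have "\<dots> = (\<Sum>m\<in>Poly_Mapping.keys p. Const (Poly_Mapping.lookup p m) *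
      (\<Prod>i<length bs. Var i ^ Poly_Mapping.lookup m i))"
    unfolding mpoly_hom_def using assms(2)
    by (intro sum.cong refl arg_cong2[where f = "(*)"] mono_val_superset) (auto simp: poly_ring_def)
  finally have "Fract p 1 = Fract (\<Sum>m\<in>Poly_Mapping.keys p. Const (Poly_Mapping.lookup p m) *
      (\<Prod>i<length bs. Var i ^ Poly_Mapping.lookup m i)) 1"
    by (rule arg_cong[where f = "\<lambda>p. Fract p 1"])
  also have "\<dots> = (\<Sum>m\<in>Poly_Mapping.keys p. Fract (Const (Poly_Mapping.lookup p m)) 1 *
      (\<Prod>i<length bs. Fract (Var i) 1 ^ Poly_Mapping.lookup m i))"
    by (simp add: Fract_1_sum Fract_1_prod Fract_1_power Fract_1_mult del: mult_fract)
  also have "\<dots> \<in> M (length bs * ?N)"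
  proof (rule inv_field.span_over_sum)
    fix m
    have "Fract (Const (Poly_Mapping.lookup p m)) 1 *
      (\<Prod>i<length bs. Fract (Var i) 1 ^ Poly_Mapping.lookup m i) \<in> M (0 + length bs * ?N)"
      by (intro deg_le_span_mult deg_le_in_span deg_le_Const prod order_refl)
    then show "Fract (Const (Poly_Mapping.lookup p m)) 1 *
      (\<Prod>i<length bs. Fract (Var i) 1 ^ Poly_Mapping.lookup m i) \<in> M (length bs * ?N)"
      by simp
  qed
  finally show ?thesis .
qed

text \<open>With \<open>N\<close> the norm of q, p / q = (1 / \<open>N\<close>) * \<open>r\<close>,
  where \<open>r\<close> is p times the conjugates of q other than q itself. So each fraction is an
  invariant scalar times a polynomial, and \<open>poly_in_span\<close> applies.\<close>

lemma spans_in_degree_exists: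
  assumes "finite (carrier G)"
  shows "spans_in_degree G scale \<rho> bs (length bs * (card (carrier G) - 1))"
proof -
  let ?D = "length bs * (card (carrier G) - 1)"
  have "x \<in> M ?D" if xK: "x \<in> K" for x
  proof -
    obtain p q where pq: "x = Fract p q" "p \<in> poly_ring (length bs)" "q \<in> poly_ring (length bs)" "q \<noteq> 0"
      using xK by (rule rat_field_cases)
    \<comment> \<open>The conjugates of \<open>q\<close> as polynomials rather than fractions, so
      that \<open>r\<close> below is visibly a polynomial.\<close>
    define Q where "Q g = pullback scale bs bs (\<rho> (inv g)) q" for g
    have Q: "Q g \<in> poly_ring (length bs)" "Q g \<noteq> 0" "act g (Fract q 1) = Fract (Q g) 1"
      if "g \<in> carrier G" for g
      using that pq act_Fract_1 pullback_nonzero[OF B B automorphism_rho_inv]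
      by (auto simp: Q_def intro: pullback_poly_ring)
    define N where "N = (\<Prod>g\<in>carrier G. act g (Fract q 1))"
    define r where "r = p * (\<Prod>g\<in>carrier G - {\<one>}. Q g)"
    have N: "N \<in> F"
      unfolding N_def using pq by (intro norm_in_inv_field rat_field_poly)
    \<comment> \<open>The factor of \<open>\<one>\<close> is \<open>q\<close> itself; splitting it
      off exhibits \<open>q\<close> as a divisor of the norm with polynomial cofactor.\<close>
    have "N = Fract q 1 * (\<Prod>g\<in>carrier G - {\<one>}. act g (Fract q 1))"
      unfolding N_def using assms one_in_carrier pq act_one[OF rat_field_poly[OF pq(3)]]
      by (simp add: prod.remove[of _ "\<one>"])
    also have "\<dots> = Fract (q * (\<Prod>g\<in>carrier G - {\<one>}. Q g)) 1"
      using Q(3) by (simp add: Fract_1_prod Fract_1_mult del: mult_fract)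
    finally have N_eq: "N = Fract (q * (\<Prod>g\<in>carrier G - {\<one>}. Q g)) 1" .
    have "q * (\<Prod>g\<in>carrier G - {\<one>}. Q g) \<noteq> 0"
      using pq(4) Q(2) assms by (auto simp: prod_zero_iff)
    then have x: "x = inverse N * Fract r 1"
      using pq(4) by (simp add: N_eq pq(1) r_def eq_fract)
    have "(\<Prod>g\<in>carrier G - {\<one>}. Q g) \<in> poly_ring (length bs)"
      using Q(1) by (intro poly_ring_prod) auto
    then have "r \<in> poly_ring (length bs)"
      unfolding r_def using pq(2) by (intro poly_ring_mult)
    then show ?thesis
      unfolding x using assms N by (intro inv_field.span_over_scale inv_field_inverse poly_in_span)
  qed
  then show ?thesis
    using span_over_rat_field[OF inv_field_subset deg_le_in_rat_field]
    by (auto simp: spans_in_degree_def)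
qed

section \<open>Restriction to a subgroup and comparison of the minima\<close>

lemma spans_in_degree_subgroup:
  assumes "subgroup H G" "spans_in_degree G scale \<rho> bs d"
  shows "spans_in_degree (G\<lparr>carrier := H\<rparr>) scale \<rho> bs d"
proof -
  interpret group G using group_hom by (simp add: group_hom_def)
  \<comment> \<open>Elements of \<open>H\<close> act as they do in \<open>G\<close>, since inverses
    in the subgroup agree with those in \<open>G\<close>; fewer conditions leave more
    invariants.\<close>
  have F_H: "F \<subseteq> inv_field (G\<lparr>carrier := H\<rparr>) scale \<rho> bs"
    using assms(1) subgroup.subset[OF assms(1)]
    by (auto simp: inv_field_def act_rat_def m_inv_consistent)
  have "span_over (inv_field (G\<lparr>carrier := H\<rparr>) scale \<rho> bs)
      ((\<lambda>p. Fract p 1) ` poly_deg_le (length bs) d) \<subseteq> K"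
    by (intro span_over_rat_field deg_le_in_rat_field) (auto simp: inv_field_def)
  moreover have "K \<subseteq> span_over (inv_field (G\<lparr>carrier := H\<rparr>) scale \<rho> bs)
      ((\<lambda>p. Fract p 1) ` poly_deg_le (length bs) d)"
    using assms(2) span_over_mono[OF F_H] by (auto simp: spans_in_degree_def)
  ultimately show ?thesis by (auto simp: spans_in_degree_def)
qed

end

end

theorem lemma4p5:
  fixes G :: "('g, 'm) monoid_scheme"
    and scale :: "'k::field \<Rightarrow> 'v::ab_group_add \<Rightarrow> 'v"
    and \<rho> :: "'g \<Rightarrow> 'v \<Rightarrow> 'v"
    and H :: "'g set"
  assumes "linear_representation G scale \<rho>"
    and "finite (carrier G)"
    and "finite_dim scale"
    and "subgroup H G"
  shows "D_span (G\<lparr>carrier := H\<rparr>) scale \<rho> \<le> D_span G scale \<rho>"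
proof -
  interpret linear_representation G scale \<rho> by fact
  \<comment> \<open>The basis chosen in \<open>D_span\<close> depends on \<open>scale\<close> alone,
    so \<open>G\<close> and \<open>H\<close> share it.\<close>
  let ?bs = "SOME bs. ordered_basis scale bs"
  have B: "ordered_basis scale ?bs"
    using assms(3) unfolding finite_dim_iff by (rule someI_ex)
  \<comment> \<open>Since some degree spans for \<open>G\<close>, the \<open>LEAST\<close> is
    attained and is a genuine spanning degree.\<close>
  have "spans_in_degree G scale \<rho> ?bs (D_span G scale \<rho>)"
    unfolding D_span_def by (rule LeastI) (rule spans_in_degree_exists[OF B assms(2)])
  then have "spans_in_degree (G\<lparr>carrier := H\<rparr>) scale \<rho> ?bs (D_span G scale \<rho>)"
    by (rule spans_in_degree_subgroup[OF B assms(4)])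
  then show ?thesis
    unfolding D_span_def[of "G\<lparr>carrier := H\<rparr>"] by (rule Least_le)
qed

end
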